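(* Let $\mathscr{A}$ be a $W^*$-algebra equipped with a $*$-conjugate-automorphism $\sharp$, and let $\mathscr{E}$ be a right Hilbert $\mathscr{A}$-module equipped with a $\sharp$-conjugation $C$. Let $\mathscr{E}'_{c,\sharp}$ be the $\sharp$-conjugate dual of $\mathscr{E}$, and let $\langle\cdot,\cdot\rangle_P$ be Paschke's $\mathscr{A}$-valued inner product on the ordinary dual $\mathscr{E}'$. Then the formula $$\langle f,g\rangle_{c,\sharp}=\langle f\circ C,g\circ C\rangle_P$$ defines an $\mathscr{A}$-valued inner product on the right $\mathscr{A}$-module $\mathscr{E}'_{c,\sharp}$, making it into a self-dual Hilbert $\mathscr{A}$-module.
   Context: A $*$-conjugate-automorphism on a $C^*$-algebra $\mathscr{A}$ is a map $\sharp:\mathscr{A}\to\mathscr{A}$, $a\mapsto a^\sharp$, such that for all $a,b\in\mathscr{A}$, $\lambda\in\mathbb{C}$: (1) $(\lambda a+b)^\sharp=\bar\lambda a^\sharp+b^\sharp$; (2) $(a^\sharp)^\sharp=a$; (3) $(a^\sharp)^*=(a^* )^\sharp$; (4) $(ab)^\sharp=a^\sharp b^\sharp$. Inner products are conjugate-linear in the first and linear in the second variable. A $\sharp$-conjugation on $\mathscr{E}$ is a bounded conjugate-linear operator $C:\mathscr{E}\to\mathscr{E}$ with $C^2=I_{\mathscr{E}}$ and $\langle Cx,Cy\rangle=\langle x,y\rangle^\sharp$ for all $x,y\in\mathscr{E}$. The $\sharp$-conjugate dual $\mathscr{E}'_{c,\sharp}$ is the set of bounded conjugate-linear maps $f:\mathscr{E}\to\mathscr{A}$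 with $f(xa)=f(x)a^\sharp$ for all $x\in\mathscr{E}$, $a\in\mathscr{A}$. The ordinary dual $\mathscr{E}'$ is the set of bounded linear maps $g:\mathscr{E}\to\mathscr{A}$ with $g(xa)=g(x)a$. Both carry the right $\mathscr{A}$-module structure $(fa)(x)=a^*f(x)$ and, compatibly, the scalar multiplication $(\lambda f)(x)=\bar\lambda f(x)$. If $f\in\mathscr{E}'_{c,\sharp}$ then $f\circ C\in\mathscr{E}'$. Paschke's theorem: for a $W^*$-algebra $\mathscr{A}$ there is an $\mathscr{A}$-valued inner product $\langle\cdot,\cdot\rangle_P$ on $\mathscr{E}'$ which extends the original inner product of $\mathscr{E}$ (where $x\in\mathscr{E}$ is identified with the functional $y\mapsto\langle x,y\rangle$) and makes $\mathscr{E}'$ a self-dual Hilbert $\mathscr{A}$-module. A Hilbert $\mathscr{A}$-module $\mathscr{X}$ is self-dual if every bounded $\mathscr{A}$-linear map $\mathscr{X}\to\mathscr{A}$ has the form $u\mapsto\langle f,u\rangle$ for some $f\in\mathscr{X}$. *)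

theory Defs
  imports "HOL-Analysis.Analysis" "HOL-Library.FuncSet"
begin

class complex_banach = banach +
  fixes scaleC :: "complex \<Rightarrow> 'a \<Rightarrow> 'a"  (infixr "*\<^sub>C" 75)
  assumes scaleC_add_right: "c *\<^sub>C (x + y) = c *\<^sub>C x + c *\<^sub>C y"
    and scaleC_add_left: "(c + d) *\<^sub>C x = c *\<^sub>C x + d *\<^sub>C x"
    and scaleC_scaleC: "c *\<^sub>C d *\<^sub>C x = (c * d) *\<^sub>C x"
    and scaleC_of_real: "complex_of_real r *\<^sub>C x = r *\<^sub>R x"
    and norm_scaleC: "norm (c *\<^sub>C x) = cmod c * norm x"

text \<open>No unit is assumed: a \<open>W\<^sup>*\<close>-algebra as defined below has one automatically, and the zero
  algebra is not excluded.\<close>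

class cstar_algebra = complex_banach + real_normed_algebra +
  fixes adj :: "'a \<Rightarrow> 'a"
  assumes mult_scaleC_left: "(c *\<^sub>C a) * b = c *\<^sub>C (a * b)"
    and mult_scaleC_right: "a * (c *\<^sub>C b) = c *\<^sub>C (a * b)"
    and adj_add: "adj (a + b) = adj a + adj b"
    and adj_scaleC: "adj (c *\<^sub>C a) = cnj c *\<^sub>C adj a"
    and adj_adj: "adj (adj a) = a"
    and adj_mult: "adj (a * b) = adj b * adj a"
    and norm_adj_mult_self: "norm (adj a * a) = (norm a)\<^sup>2"

definition positive :: "'a::cstar_algebra \<Rightarrow> bool"
  where "positive a \<longleftrightarrow> (\<exists>b. a = adj b * b)"

definition bounded_complex_functionals :: "('p::complex_banach \<Rightarrow> complex) set"
  where "bounded_complex_functionals = {\<phi>. bounded_linear \<phi> \<and> (\<forall>c p. \<phi> (c *\<^sub>C p) = c * \<phi> p)}"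

text \<open>A \<open>W\<^sup>*\<close>-algebra is a \<open>C\<^sup>*\<close>-algebra that is isometrically isomorphic, as a complex Banach space,
  to the dual of some complex Banach space. HOL cannot quantify over the predual type inside a
  formula, so the predual \<^typ>\<open>'p\<close> is a second type argument; in a hypothesis, where \<^typ>\<open>'p\<close>
  occurs nowhere else, universal quantification over it is the required existential.\<close>

definition wstar_algebra :: "'a::cstar_algebra itself \<Rightarrow> 'p::complex_banach itself \<Rightarrow> bool"
  where "wstar_algebra TYPE('a) TYPE('p) \<longleftrightarrow>
    (\<exists>J :: 'a \<Rightarrow> 'p \<Rightarrow> complex.
        bij_betw J UNIV bounded_complex_functionals \<and>
        (\<forall>a b p. J (a + b) p = J a p + J b p) \<and>
        (\<forall>c a p. J (c *\<^sub>C a) p = c * J a p) \<and>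
        (\<forall>a. onorm (J a) = norm a))"

definition star_conj_automorphism :: "('a::cstar_algebra \<Rightarrow> 'a) \<Rightarrow> bool"
  where "star_conj_automorphism sharp \<longleftrightarrow>
    (\<forall>c a b. sharp (c *\<^sub>C a + b) = cnj c *\<^sub>C sharp a + sharp b) \<and>
    (\<forall>a. sharp (sharp a) = a) \<and>
    (\<forall>a. adj (sharp a) = sharp (adj a)) \<and>
    (\<forall>a b. sharp (a * b) = sharp a * sharp b)"

record ('a, 'e) module_ops =
  carrier :: "'e set"
  mzero :: 'e
  madd :: "'e \<Rightarrow> 'e \<Rightarrow> 'e"  (infixl "\<oplus>\<index>" 65)
  mscale :: "complex \<Rightarrow> 'e \<Rightarrow> 'e"  (infixr "\<odot>\<index>" 75)
  mact :: "'e \<Rightarrow> 'a \<Rightarrow> 'e"  (infixl "\<cdot>\<index>" 70)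

locale right_module =
  fixes M :: "('a::cstar_algebra, 'e) module_ops" (structure)
  assumes zero_closed: "mzero M \<in> carrier M"
    and add_closed: "\<lbrakk>x \<in> carrier M; y \<in> carrier M\<rbrakk> \<Longrightarrow> x \<oplus> y \<in> carrier M"
    and scale_closed: "x \<in> carrier M \<Longrightarrow> c \<odot> x \<in> carrier M"
    and act_closed: "x \<in> carrier M \<Longrightarrow> x \<cdot> a \<in> carrier M"
    and add_assoc: "\<lbrakk>x \<in> carrier M; y \<in> carrier M; z \<in> carrier M\<rbrakk> \<Longrightarrow> (x \<oplus> y) \<oplus> z = x \<oplus> (y \<oplus> z)"
    and add_commute: "\<lbrakk>x \<in> carrier M; y \<in> carrier M\<rbrakk> \<Longrightarrow> x \<oplus> y = y \<oplus> x"
    and add_zero: "x \<in> carrier M \<Longrightarrow> x \<oplus> mzero M = x"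
    and add_neg: "x \<in> carrier M \<Longrightarrow> x \<oplus> (- 1) \<odot> x = mzero M"
    and scale_add: "\<lbrakk>x \<in> carrier M; y \<in> carrier M\<rbrakk> \<Longrightarrow> c \<odot> (x \<oplus> y) = c \<odot> x \<oplus> c \<odot> y"
    and add_scale: "x \<in> carrier M \<Longrightarrow> (c + d) \<odot> x = c \<odot> x \<oplus> d \<odot> x"
    and scale_scale: "x \<in> carrier M \<Longrightarrow> c \<odot> d \<odot> x = (c * d) \<odot> x"
    and scale_one: "x \<in> carrier M \<Longrightarrow> 1 \<odot> x = x"
    and act_add_left: "\<lbrakk>x \<in> carrier M; y \<in> carrier M\<rbrakk> \<Longrightarrow> (x \<oplus> y) \<cdot> a = x \<cdot> a \<oplus> y \<cdot> a"
    and act_add_right: "x \<in> carrier M \<Longrightarrow> x \<cdot> (a + b) = x \<cdot> a \<oplus> x \<cdot> b"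
    and act_mult: "x \<in> carrier M \<Longrightarrow> x \<cdot> (a * b) = (x \<cdot> a) \<cdot> b"
    and scale_act: "x \<in> carrier M \<Longrightarrow> c \<odot> (x \<cdot> a) = (c \<odot> x) \<cdot> a"
    and act_scaleC: "x \<in> carrier M \<Longrightarrow> x \<cdot> (c *\<^sub>C a) = c \<odot> (x \<cdot> a)"

locale inner_product_module = right_module M
  for M :: "('a::cstar_algebra, 'e) module_ops" (structure) +
  fixes ip :: "'e \<Rightarrow> 'e \<Rightarrow> 'a"
  assumes ip_add: "\<lbrakk>x \<in> carrier M; y \<in> carrier M; z \<in> carrier M\<rbrakk> \<Longrightarrow> ip x (y \<oplus> z) = ip x y + ip x z"
    and ip_scale: "\<lbrakk>x \<in> carrier M; y \<in> carrier M\<rbrakk> \<Longrightarrow> ip x (c \<odot> y) = c *\<^sub>C ip x y"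
    and ip_act: "\<lbrakk>x \<in> carrier M; y \<in> carrier M\<rbrakk> \<Longrightarrow> ip x (y \<cdot> a) = ip x y * a"
    and ip_adj: "\<lbrakk>x \<in> carrier M; y \<in> carrier M\<rbrakk> \<Longrightarrow> adj (ip x y) = ip y x"
    and ip_positive: "x \<in> carrier M \<Longrightarrow> positive (ip x x)"
    and ip_definite: "\<lbrakk>x \<in> carrier M; ip x x = 0\<rbrakk> \<Longrightarrow> x = mzero M"

definition mnorm :: "('e \<Rightarrow> 'e \<Rightarrow> 'a::cstar_algebra) \<Rightarrow> 'e \<Rightarrow> real"
  where "mnorm ip x = sqrt (norm (ip x x))"

locale hilbert_module = inner_product_module M ip
  for M :: "('a::cstar_algebra, 'e) module_ops" (structure) and ip :: "'e \<Rightarrow> 'e \<Rightarrow> 'a" +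
  assumes complete:
    "\<lbrakk>\<And>n. X n \<in> carrier M;
      \<And>\<epsilon>. \<epsilon> > 0 \<Longrightarrow> \<exists>N. \<forall>m\<ge>N. \<forall>n\<ge>N. mnorm ip (X m \<oplus> (- 1) \<odot> X n) < \<epsilon>\<rbrakk>
     \<Longrightarrow> \<exists>x\<in>carrier M. (\<lambda>n::nat. mnorm ip (X n \<oplus> (- 1) \<odot> x)) \<longlonglongrightarrow> 0"

text \<open>Functionals on a module are functions on the whole type that are \<^const>\<open>undefined\<close> off the
  carrier, so that equality of functionals is equality on the carrier.\<close>

definition dual_set :: "('a::cstar_algebra, 'e) module_ops \<Rightarrow> ('e \<Rightarrow> 'e \<Rightarrow> 'a) \<Rightarrow> ('e \<Rightarrow> 'a) set"
  where "dual_set M ip = {g \<in> extensional (carrier M).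
    (\<forall>x\<in>carrier M. \<forall>y\<in>carrier M. g (x \<oplus>\<^bsub>M\<^esub> y) = g x + g y) \<and>
    (\<forall>x\<in>carrier M. \<forall>c. g (c \<odot>\<^bsub>M\<^esub> x) = c *\<^sub>C g x) \<and>
    (\<forall>x\<in>carrier M. \<forall>a. g (x \<cdot>\<^bsub>M\<^esub> a) = g x * a) \<and>
    (\<exists>K. \<forall>x\<in>carrier M. norm (g x) \<le> K * mnorm ip x)}"

definition conj_dual_set ::
    "('a::cstar_algebra, 'e) module_ops \<Rightarrow> ('e \<Rightarrow> 'e \<Rightarrow> 'a) \<Rightarrow> ('a \<Rightarrow> 'a) \<Rightarrow> ('e \<Rightarrow> 'a) set"
  where "conj_dual_set M ip sharp = {f \<in> extensional (carrier M).
    (\<forall>x\<in>carrier M. \<forall>y\<in>carrier M. f (x \<oplus>\<^bsub>M\<^esub> y) = f x + f y) \<and>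
    (\<forall>x\<in>carrier M. \<forall>c. f (c \<odot>\<^bsub>M\<^esub> x) = cnj c *\<^sub>C f x) \<and>
    (\<forall>x\<in>carrier M. \<forall>a. f (x \<cdot>\<^bsub>M\<^esub> a) = f x * sharp a) \<and>
    (\<exists>K. \<forall>x\<in>carrier M. norm (f x) \<le> K * mnorm ip x)}"

definition functional_ops :: "'e set \<Rightarrow> ('e \<Rightarrow> 'a::cstar_algebra) set \<Rightarrow> ('a, 'e \<Rightarrow> 'a) module_ops"
  where "functional_ops S F =
    \<lparr>carrier = F,
     mzero = (\<lambda>x\<in>S. 0),
     madd = (\<lambda>f g. \<lambda>x\<in>S. f x + g x),
     mscale = (\<lambda>c f. \<lambda>x\<in>S. cnj c *\<^sub>C f x),
     mact = (\<lambda>f a. \<lambda>x\<in>S. adj a * f x)\<rparr>"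

definition dual_module ::
    "('a::cstar_algebra, 'e) module_ops \<Rightarrow> ('e \<Rightarrow> 'e \<Rightarrow> 'a) \<Rightarrow> ('a, 'e \<Rightarrow> 'a) module_ops"
  where "dual_module M ip = functional_ops (carrier M) (dual_set M ip)"

definition conj_dual_module ::
    "('a::cstar_algebra, 'e) module_ops \<Rightarrow> ('e \<Rightarrow> 'e \<Rightarrow> 'a) \<Rightarrow> ('a \<Rightarrow> 'a) \<Rightarrow> ('a, 'e \<Rightarrow> 'a) module_ops"
  where "conj_dual_module M ip sharp = functional_ops (carrier M) (conj_dual_set M ip sharp)"

definition self_dual :: "('a::cstar_algebra, 'e) module_ops \<Rightarrow> ('e \<Rightarrow> 'e \<Rightarrow> 'a) \<Rightarrow> bool"
  where "self_dual M ip \<longleftrightarrow>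
    (\<forall>g\<in>dual_set M ip. \<exists>f\<in>carrier M. \<forall>u\<in>carrier M. g u = ip f u)"

definition sharp_conjugation ::
    "('a::cstar_algebra, 'e) module_ops \<Rightarrow> ('e \<Rightarrow> 'e \<Rightarrow> 'a) \<Rightarrow> ('a \<Rightarrow> 'a) \<Rightarrow> ('e \<Rightarrow> 'e) \<Rightarrow> bool"
  where "sharp_conjugation M ip sharp C \<longleftrightarrow>
    C \<in> carrier M \<rightarrow> carrier M \<and>
    (\<forall>x\<in>carrier M. \<forall>y\<in>carrier M. C (x \<oplus>\<^bsub>M\<^esub> y) = C x \<oplus>\<^bsub>M\<^esub> C y) \<and>
    (\<forall>x\<in>carrier M. \<forall>c. C (c \<odot>\<^bsub>M\<^esub> x) = cnj c \<odot>\<^bsub>M\<^esub> C x) \<and>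
    (\<exists>K. \<forall>x\<in>carrier M. mnorm ip (C x) \<le> K * mnorm ip x) \<and>
    (\<forall>x\<in>carrier M. C (C x) = x) \<and>
    (\<forall>x\<in>carrier M. \<forall>y\<in>carrier M. ip (C x) (C y) = sharp (ip x y))"

definition dual_embedding ::
    "('a::cstar_algebra, 'e) module_ops \<Rightarrow> ('e \<Rightarrow> 'e \<Rightarrow> 'a) \<Rightarrow> 'e \<Rightarrow> 'e \<Rightarrow> 'a"
  where "dual_embedding M ip x = (\<lambda>y\<in>carrier M. ip x y)"

text \<open>The defining property of Paschke's inner product on the dual; existence for modules over
  \<open>W\<^sup>*\<close>-algebras is Paschke's theorem.\<close>

definition paschke_inner_product ::
    "('a::cstar_algebra, 'e) module_ops \<Rightarrow> ('e \<Rightarrow> 'e \<Rightarrow> 'a)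
      \<Rightarrow> (('e \<Rightarrow> 'a) \<Rightarrow> ('e \<Rightarrow> 'a) \<Rightarrow> 'a) \<Rightarrow> bool"
  where "paschke_inner_product M ip P \<longleftrightarrow>
    hilbert_module (dual_module M ip) P \<and>
    (\<forall>x\<in>carrier M. \<forall>y\<in>carrier M. P (dual_embedding M ip x) (dual_embedding M ip y) = ip x y) \<and>
    self_dual (dual_module M ip) P"

definition conj_dual_ip ::
    "('a::cstar_algebra, 'e) module_ops \<Rightarrow> ('e \<Rightarrow> 'e) \<Rightarrow> (('e \<Rightarrow> 'a) \<Rightarrow> ('e \<Rightarrow> 'a) \<Rightarrow> 'a)
      \<Rightarrow> ('e \<Rightarrow> 'a) \<Rightarrow> ('e \<Rightarrow> 'a) \<Rightarrow> 'a"
  where "conj_dual_ip M C P f g = P (compose (carrier M) f C) (compose (carrier M) g C)"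

end

theory Submission
  imports Defs
begin

text \<open>The map \<open>f \<mapsto> f \<circ> C\<close> is an isomorphism of right modules from the conjugate dual onto the ordinary
  dual, with inverse \<open>g \<mapsto> g \<circ> C\<close>: a \<open>\<sharp>\<close>-conjugation automatically satisfies
  \<open>C (x a) = (C x) a\<^sup>\<sharp>\<close>, so composition with \<open>C\<close> turns \<open>\<sharp>\<close>-conjugate functionals into linear ones and
  back. The inner product in question is the pull-back of Paschke's one along this isomorphism, so
  completeness and self-duality are transported.\<close>

section \<open>Separation of points by an inner product, and the module law of a conjugation\<close>

lemma scaleC_minus_one: "(- 1) *\<^sub>C a = - (a :: 'a::complex_banach)"
  using scaleC_of_real[of "- 1" a] by simp

lemma (in right_module) eq_of_diff_zero:
  assumes "x \<in> carrier M" "y \<in> carrier M" "x \<oplus> (- 1) \<odot> y = mzero M"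
  shows "x = y"
proof -
  have y': "(- 1) \<odot> y \<in> carrier M"
    using assms scale_closed by blast
  have "x = x \<oplus> ((- 1) \<odot> y \<oplus> y)"
    using assms y' by (simp add: add_commute[of "(- 1) \<odot> y" y] add_neg add_zero)
  also have "\<dots> = (x \<oplus> (- 1) \<odot> y) \<oplus> y"
    using assms(1,2) y' by (simp only: add_assoc)
  also have "\<dots> = y"
    using assms by (simp add: add_commute[of "mzero M" y] zero_closed add_zero)
  finally show ?thesis .
qed

text \<open>Testing the difference \<open>d\<close> of the two elements against itself gives
  \<open>ip d d = 0\<close>, so definiteness applies.\<close>

lemma (in inner_product_module) eqI_ip:
  assumes x: "x \<in> carrier M" and y: "y \<in> carrier M"
    and eq: "\<And>z. z \<in> carrier M \<Longrightarrow> ip z x = ip z y"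
  shows "x = y"
proof -
  define d where "d = x \<oplus> (- 1) \<odot> y"
  have y': "(- 1) \<odot> y \<in> carrier M" and d: "d \<in> carrier M"
    using x y by (simp_all add: d_def scale_closed add_closed)
  have "ip d d = ip d x + ip d ((- 1) \<odot> y)"
    using ip_add[OF d x y'] by (simp add: d_def)
  also have "\<dots> = 0"
    using d y eq[OF d] by (simp add: ip_scale scaleC_minus_one)
  finally have "d = mzero M"
    using d ip_definite by blast
  then show ?thesis
    using x y eq_of_diff_zero by (simp add: d_def)
qed

text \<open>Writing a test vector \<open>z\<close> as \<open>C (C z)\<close> lets \<open>C\<close>
  leave the inner product as \<open>sharp\<close>, whose multiplicativity splits off
  \<open>sharp a\<close>. Both sides then have the same inner product with every
  \<open>z\<close>.\<close>

lemma sharp_conjugation_act: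
  assumes E: "inner_product_module E ip"
    and sharp: "star_conj_automorphism sharp"
    and C: "sharp_conjugation E ip sharp C"
    and x: "x \<in> carrier E"
  shows "C (x \<cdot>\<^bsub>E\<^esub> a) = C x \<cdot>\<^bsub>E\<^esub> sharp a"
proof -
  interpret E: inner_product_module E ip by fact
  have CE: "C z \<in> carrier E" and CC: "C (C z) = z" if "z \<in> carrier E" for z
    using C that by (auto simp: sharp_conjugation_def)
  have ipC: "ip (C y) (C z) = sharp (ip y z)" if "y \<in> carrier E" "z \<in> carrier E" for y z
    using C that by (auto simp: sharp_conjugation_def)
  have sharp_mult: "sharp (b * c) = sharp b * sharp c" for b c
    using sharp by (auto simp: star_conj_automorphism_def)
  show ?thesis
  proof (rule E.eqI_ip)
    fix z assume z: "z \<in> carrier E"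
    have "ip z (C (x \<cdot>\<^bsub>E\<^esub> a)) = ip (C (C z)) (C (x \<cdot>\<^bsub>E\<^esub> a))"
      using z CC by simp
    also have "\<dots> = sharp (ip (C z) x) * sharp a"
      using x z CE by (simp add: ipC E.act_closed E.ip_act sharp_mult)
    also have "\<dots> = ip (C (C z)) (C x) * sharp a"
      using x z CE by (simp only: ipC)
    also have "\<dots> = ip z (C x \<cdot>\<^bsub>E\<^esub> sharp a)"
      using x z CE CC by (simp add: E.ip_act)
    finally show "ip z (C (x \<cdot>\<^bsub>E\<^esub> a)) = ip z (C x \<cdot>\<^bsub>E\<^esub> sharp a)" .
  qed (use x CE E.act_closed in auto)
qed

section \<open>Transport of structure along a module isomorphism\<close>

text \<open>On \<open>M\<close> only closure under the operations is required. The module laws are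
  not assumed on either side, so those of \<open>N\<close> can be pulled back.\<close>

locale module_isomorphism =
  fixes M :: "('a::cstar_algebra, 'e) module_ops"
    and N :: "('a, 'f) module_ops"
    and T :: "'e \<Rightarrow> 'f"
  assumes bij: "bij_betw T (carrier M) (carrier N)"
    and zero_closed: "mzero M \<in> carrier M"
    and add_closed: "\<lbrakk>x \<in> carrier M; y \<in> carrier M\<rbrakk> \<Longrightarrow> x \<oplus>\<^bsub>M\<^esub> y \<in> carrier M"
    and scale_closed: "x \<in> carrier M \<Longrightarrow> c \<odot>\<^bsub>M\<^esub> x \<in> carrier M"
    and act_closed: "x \<in> carrier M \<Longrightarrow> x \<cdot>\<^bsub>M\<^esub> a \<in> carrier M"
    and map_zero: "T (mzero M) = mzero N"
    and map_add: "\<lbrakk>x \<in> carrier M; y \<in> carrier M\<rbrakk> \<Longrightarrow> T (x \<oplus>\<^bsub>M\<^esub> y) = T x \<oplus>\<^bsub>N\<^esub> T y"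
    and map_scale: "x \<in> carrier M \<Longrightarrow> T (c \<odot>\<^bsub>M\<^esub> x) = c \<odot>\<^bsub>N\<^esub> T x"
    and map_act: "x \<in> carrier M \<Longrightarrow> T (x \<cdot>\<^bsub>M\<^esub> a) = T x \<cdot>\<^bsub>N\<^esub> a"
begin

lemma map_closed: "x \<in> carrier M \<Longrightarrow> T x \<in> carrier N"
  using bij by (auto simp: bij_betw_def)

lemma map_eqD: "\<lbrakk>T x = T y; x \<in> carrier M; y \<in> carrier M\<rbrakk> \<Longrightarrow> x = y"
  using bij by (auto simp: bij_betw_def inj_on_def)

lemma map_surj:
  assumes "u \<in> carrier N"
  obtains x where "x \<in> carrier M" "T x = u"
  using assms bij by (metis bij_betw_imp_surj_on imageE)

lemmas closed = zero_closed add_closed scale_closed act_closed map_closed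
lemmas map_ops = map_zero map_add map_scale map_act

lemma right_module_pullback:
  assumes "right_module N"
  shows "right_module M"
proof -
  interpret N: right_module N by fact
  show ?thesis
    by unfold_locales
      \<comment> \<open>Each law is an equation in \<open>M\<close>; by injectivity it suffices to
        compare images, and there it is the same law of \<open>N\<close>.\<close>
      (rule closed map_eqD;
       simp add: closed map_ops N.add_assoc N.add_zero N.add_neg N.scale_add N.add_scale
         N.scale_scale N.scale_one N.act_add_left N.act_add_right N.act_mult N.scale_act
         N.act_scaleC N.add_commute)+
qed

lemma inner_product_module_pullback:
  assumes "inner_product_module N P"
  shows "inner_product_module M (\<lambda>x y. P (T x) (T y))"
proof -
  interpret N: inner_product_module N P by fact
  interpret M: right_module M
    by (rule right_module_pullback) unfold_locales
  show ?thesis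
  proof unfold_locales
    show "x = mzero M" if "x \<in> carrier M" "P (T x) (T x) = 0" for x
      using that N.ip_definite by (intro map_eqD) (simp_all add: closed map_zero)
  qed (simp_all add: closed map_ops N.ip_add N.ip_scale N.ip_act N.ip_adj N.ip_positive)
qed

text \<open>\<open>T\<close> preserves the norms of differences, so a Cauchy sequence has a Cauchy
  image. The limit in \<open>N\<close> lifts back because \<open>T\<close> is surjective.\<close>

lemma hilbert_module_pullback:
  assumes "hilbert_module N P"
  shows "hilbert_module M (\<lambda>x y. P (T x) (T y))"
proof -
  interpret N: hilbert_module N P by fact
  interpret M: inner_product_module M "\<lambda>x y. P (T x) (T y)"
    by (rule inner_product_module_pullback) unfold_locales
  have norm_diff: "mnorm (\<lambda>x y. P (T x) (T y)) (x \<oplus>\<^bsub>M\<^esub> (- 1) \<odot>\<^bsub>M\<^esub> y)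
      = mnorm P (T x \<oplus>\<^bsub>N\<^esub> (- 1) \<odot>\<^bsub>N\<^esub> T y)" if "x \<in> carrier M" "y \<in> carrier M" for x y
    using that by (simp add: mnorm_def closed map_ops)
  show ?thesis
  proof unfold_locales
    fix X :: "nat \<Rightarrow> 'e"
    assume X: "\<And>n. X n \<in> carrier M"
      and cauchy: "\<And>\<epsilon>. \<epsilon> > 0 \<Longrightarrow> \<exists>N. \<forall>m\<ge>N. \<forall>n\<ge>N.
        mnorm (\<lambda>x y. P (T x) (T y)) (X m \<oplus>\<^bsub>M\<^esub> (- 1) \<odot>\<^bsub>M\<^esub> X n) < \<epsilon>"
    have "\<exists>u\<in>carrier N. (\<lambda>n. mnorm P (T (X n) \<oplus>\<^bsub>N\<^esub> (- 1) \<odot>\<^bsub>N\<^esub> u)) \<longlonglongrightarrow> 0"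
      using cauchy by (intro N.complete) (simp_all add: X map_closed norm_diff)
    then obtain x where "x \<in> carrier M"
      "(\<lambda>n. mnorm P (T (X n) \<oplus>\<^bsub>N\<^esub> (- 1) \<odot>\<^bsub>N\<^esub> T x)) \<longlonglongrightarrow> 0"
      by (metis map_surj)
    then show "\<exists>x\<in>carrier M.
        (\<lambda>n. mnorm (\<lambda>x y. P (T x) (T y)) (X n \<oplus>\<^bsub>M\<^esub> (- 1) \<odot>\<^bsub>M\<^esub> x)) \<longlonglongrightarrow> 0"
      by (auto simp: X norm_diff)
  qed
qed

text \<open>A functional \<open>g\<close> on \<open>M\<close> is moved to \<open>g\<close> after the
  inverse of \<open>T\<close>. If \<open>n\<close> represents it on \<open>N\<close>, the preimage
  of \<open>n\<close> represents \<open>g\<close>.\<close>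

lemma self_dual_pullback:
  assumes "right_module N" and dual: "self_dual N P"
  shows "self_dual M (\<lambda>x y. P (T x) (T y))"
  unfolding self_dual_def
proof
  interpret N: right_module N by fact
  fix g assume g: "g \<in> dual_set M (\<lambda>x y. P (T x) (T y))"
  then obtain K where K: "norm (g x) \<le> K * mnorm P (T x)" if "x \<in> carrier M" for x
    unfolding dual_set_def mnorm_def by blast
  define S where "S = inv_into (carrier M) T"
  have S: "S u \<in> carrier M" "T (S u) = u" if "u \<in> carrier N" for u
    using that bij unfolding S_def
    by (auto simp: bij_betw_def inv_into_into f_inv_into_f)
  have ST: "S (T x) = x" if "x \<in> carrier M" for x
    using that by (meson S map_closed map_eqD)
  \<comment> \<open>The inverse of a map respecting the operations respects them too: apply
    \<open>T\<close> to both sides.\<close>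
  have S_ops: "S (u \<oplus>\<^bsub>N\<^esub> v) = S u \<oplus>\<^bsub>M\<^esub> S v" "S (c \<odot>\<^bsub>N\<^esub> u) = c \<odot>\<^bsub>M\<^esub> S u"
    "S (u \<cdot>\<^bsub>N\<^esub> a) = S u \<cdot>\<^bsub>M\<^esub> a" if "u \<in> carrier N" "v \<in> carrier N" for u v c a
    using that
    by (auto intro!: map_eqD simp: S closed map_ops N.add_closed N.scale_closed N.act_closed)
  have "(\<lambda>u\<in>carrier N. g (S u)) \<in> dual_set N P"
    unfolding dual_set_def
  proof (intro CollectI conjI ballI allI)
    \<comment> \<open>The bound \<open>K\<close> of \<open>g\<close> still serves, since
      \<open>T (S u) = u\<close>.\<close>
    show "\<exists>K. \<forall>u\<in>carrier N. norm ((\<lambda>u\<in>carrier N. g (S u)) u) \<le> K * mnorm P u"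
      using K S by (metis restrict_apply')
  qed (use g in \<open>simp_all add: dual_set_def S S_ops N.add_closed N.scale_closed N.act_closed\<close>)
  then obtain n where n: "n \<in> carrier N" "\<And>u. u \<in> carrier N \<Longrightarrow> g (S u) = P n u"
    using dual unfolding self_dual_def by (metis restrict_apply')
  then have "\<forall>u\<in>carrier M. g u = P (T (S n)) (T u)"
    by (metis S(2) ST map_closed)
  then show "\<exists>f\<in>carrier M. \<forall>u\<in>carrier M. g u = P (T f) (T u)"
    using S n by blast
qed

end

section \<open>Composition with the conjugation\<close>

locale sharp_conjugation_module = inner_product_module E ip
  for E :: "('a::cstar_algebra, 'e) module_ops" and ip :: "'e \<Rightarrow> 'e \<Rightarrow> 'a" +
  fixes sharp :: "'a \<Rightarrow> 'a" and C :: "'e \<Rightarrow> 'e"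
  assumes sharp: "star_conj_automorphism sharp"
    and conjugation: "sharp_conjugation E ip sharp C"
begin

lemma conj_closed: "x \<in> carrier E \<Longrightarrow> C x \<in> carrier E"
  and conj_conj: "x \<in> carrier E \<Longrightarrow> C (C x) = x"
  and conj_add: "\<lbrakk>x \<in> carrier E; y \<in> carrier E\<rbrakk> \<Longrightarrow> C (x \<oplus>\<^bsub>E\<^esub> y) = C x \<oplus>\<^bsub>E\<^esub> C y"
  and conj_scale: "x \<in> carrier E \<Longrightarrow> C (c \<odot>\<^bsub>E\<^esub> x) = cnj c \<odot>\<^bsub>E\<^esub> C x"
  using conjugation by (auto simp: sharp_conjugation_def)

lemma conj_act: "x \<in> carrier E \<Longrightarrow> C (x \<cdot>\<^bsub>E\<^esub> a) = C x \<cdot>\<^bsub>E\<^esub> sharp a"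
  using sharp_conjugation_act[OF inner_product_module_axioms sharp conjugation] .

lemma sharp_sharp: "sharp (sharp a) = a"
  using sharp by (auto simp: star_conj_automorphism_def)

lemma compose_conj_bounded:
  assumes "\<exists>K. \<forall>x\<in>carrier E. norm (f x) \<le> K * mnorm ip x"
  shows "\<exists>K. \<forall>x\<in>carrier E. norm (compose (carrier E) f C x) \<le> K * mnorm ip x"
proof -
  obtain K where K: "\<And>x. x \<in> carrier E \<Longrightarrow> norm (f x) \<le> K * mnorm ip x"
    using assms by blast
  obtain L where L: "\<And>x. x \<in> carrier E \<Longrightarrow> mnorm ip (C x) \<le> L * mnorm ip x"
    using conjugation unfolding sharp_conjugation_def by blast
  have "norm (compose (carrier E) f C x) \<le> (\<bar>K\<bar> * L) * mnorm ip x" if x: "x \<in> carrier E" for x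
  proof -
    \<comment> \<open>\<open>K\<close> may be negative; its absolute value keeps the direction of
      the inequality when the bound for \<open>C\<close> is multiplied in.\<close>
    have "norm (f (C x)) \<le> \<bar>K\<bar> * mnorm ip (C x)"
      using K[OF conj_closed[OF x]]
      by (rule order_trans) (simp add: mult_right_mono mnorm_def)
    also have "\<dots> \<le> \<bar>K\<bar> * (L * mnorm ip x)"
      using L[OF x] by (intro mult_left_mono) auto
    finally show ?thesis
      using x by (simp add: compose_eq mult.assoc)
  qed
  then show ?thesis by blast
qed

text \<open>The twists of \<open>f\<close> and of \<open>C\<close> cancel: \<open>cnj\<close>
  against \<open>cnj\<close>, and \<open>sharp\<close> against \<open>sharp\<close>.\<close>

lemma compose_conj_dual_set:
  "f \<in> conj_dual_set E ip sharp \<Longrightarrow> compose (carrier E) f C \<in> dual_set E ip"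
  using compose_conj_bounded[of f]
  by (simp add: conj_dual_set_def dual_set_def compose_eq add_closed scale_closed act_closed
      conj_closed conj_add conj_scale conj_act sharp_sharp)

text \<open>Here \<open>g\<close> is untwisted, so \<open>cnj\<close> and \<open>sharp\<close> come
  from \<open>C\<close> alone.\<close>

lemma compose_dual_set:
  "g \<in> dual_set E ip \<Longrightarrow> compose (carrier E) g C \<in> conj_dual_set E ip sharp"
  using compose_conj_bounded[of g]
  by (simp add: conj_dual_set_def dual_set_def compose_eq add_closed scale_closed act_closed
      conj_closed conj_add conj_scale conj_act)

lemma compose_compose_conj:
  "f \<in> extensional (carrier E) \<Longrightarrow> compose (carrier E) (compose (carrier E) f C) C = f"
  by (rule extensionalityI[of _ "carrier E"]) (simp_all add: compose_eq conj_closed conj_conj)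

text \<open>Composing twice with \<open>C\<close> restores \<open>f\<close>. The criterion lets
  closure of the conjugate dual under the operations be read off from the ordinary dual.\<close>

lemma conj_dual_set_iff:
  "f \<in> conj_dual_set E ip sharp \<longleftrightarrow>
    f \<in> extensional (carrier E) \<and> compose (carrier E) f C \<in> dual_set E ip"
proof
  assume "f \<in> extensional (carrier E) \<and> compose (carrier E) f C \<in> dual_set E ip"
  then show "f \<in> conj_dual_set E ip sharp"
    using compose_dual_set[of "compose (carrier E) f C"] by (simp add: compose_compose_conj)
qed (use compose_conj_dual_set in \<open>auto simp: conj_dual_set_def\<close>)

lemma module_isomorphism_compose:
  assumes "right_module (dual_module E ip)"
  shows "module_isomorphism (conj_dual_module E ip sharp) (dual_module E ip)
    (\<lambda>f. compose (carrier E) f C)"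
proof -
  interpret D: right_module "dual_module E ip" by fact
  let ?M = "conj_dual_module E ip sharp" and ?N = "dual_module E ip"
  let ?T = "\<lambda>f. compose (carrier E) f C"
  note defs = conj_dual_module_def dual_module_def functional_ops_def
  \<comment> \<open>Both modules carry the same pointwise operations on values, while
    \<open>?T\<close> only changes the argument; hence no twist appears.\<close>
  have ops: "?T (mzero ?M) = mzero ?N" "?T (f \<oplus>\<^bsub>?M\<^esub> g) = ?T f \<oplus>\<^bsub>?N\<^esub> ?T g"
    "?T (c \<odot>\<^bsub>?M\<^esub> f) = c \<odot>\<^bsub>?N\<^esub> ?T f" "?T (f \<cdot>\<^bsub>?M\<^esub> a) = ?T f \<cdot>\<^bsub>?N\<^esub> a" for f g c a
    by (auto simp: defs compose_def conj_closed intro!: restrict_ext)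
  have ext: "mzero ?M \<in> extensional (carrier E)" "f \<oplus>\<^bsub>?M\<^esub> g \<in> extensional (carrier E)"
    "c \<odot>\<^bsub>?M\<^esub> f \<in> extensional (carrier E)" "f \<cdot>\<^bsub>?M\<^esub> a \<in> extensional (carrier E)" for f g c a
    by (simp_all add: defs)
  have M: "f \<in> carrier ?M \<longleftrightarrow> f \<in> extensional (carrier E) \<and> ?T f \<in> carrier ?N" for f
    by (simp add: defs conj_dual_set_iff)
  have "bij_betw ?T (carrier ?M) (carrier ?N)"
  \<comment> \<open>Since \<open>C\<close> is an involution, the same formula gives the
    inverse.\<close>
  proof (rule bij_betw_byWitness[where f' = ?T])
    show "?T ` carrier ?N \<subseteq> carrier ?M"
      using compose_dual_set by (auto simp: defs)
    show "?T ` carrier ?M \<subseteq> carrier ?N"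
      using M by blast
    show "\<forall>f\<in>carrier ?M. ?T (?T f) = f"
      using M compose_compose_conj by blast
    show "\<forall>g\<in>carrier ?N. ?T (?T g) = g"
      by (simp add: defs dual_set_def compose_compose_conj)
  qed
  then show ?thesis
    by unfold_locales
      (simp_all add: M ops ext D.zero_closed D.add_closed D.scale_closed D.act_closed)
qed

end

theorem theorem4p10:
  fixes E :: "('a::cstar_algebra, 'e) module_ops"
    and ip :: "'e \<Rightarrow> 'e \<Rightarrow> 'a"
    and sharp :: "'a \<Rightarrow> 'a"
    and C :: "'e \<Rightarrow> 'e"
    and P :: "('e \<Rightarrow> 'a) \<Rightarrow> ('e \<Rightarrow> 'a) \<Rightarrow> 'a"
  assumes "wstar_algebra TYPE('a) TYPE('p::complex_banach)"
    and "star_conj_automorphism sharp"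
    and "hilbert_module E ip"
    and "sharp_conjugation E ip sharp C"
    and "paschke_inner_product E ip P"
  shows "(\<forall>f\<in>conj_dual_set E ip sharp. compose (carrier E) f C \<in> dual_set E ip) \<and>
    inner_product_module (conj_dual_module E ip sharp) (conj_dual_ip E C P) \<and>
    hilbert_module (conj_dual_module E ip sharp) (conj_dual_ip E C P) \<and>
    self_dual (conj_dual_module E ip sharp) (conj_dual_ip E C P)"
proof -
  interpret E: hilbert_module E ip by fact
  interpret sharp_conjugation_module E ip sharp C
    using assms by unfold_locales
  have P: "hilbert_module (dual_module E ip) P" "self_dual (dual_module E ip) P"
    using assms(5) by (simp_all add: paschke_inner_product_def)
  interpret P: hilbert_module "dual_module E ip" P by fact
  interpret module_isomorphism "conj_dual_module E ip sharp" "dual_module E ip"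
    "\<lambda>f. compose (carrier E) f C"
    by (rule module_isomorphism_compose) unfold_locales
  \<comment> \<open>This exhibits the inner product as the pull-back of \<open>P\<close> in the form
    the transport results produce.\<close>
  have ip_eq: "conj_dual_ip E C P = (\<lambda>f g. P (compose (carrier E) f C) (compose (carrier E) g C))"
    by (simp add: conj_dual_ip_def fun_eq_iff)
  show ?thesis
    unfolding ip_eq
    using compose_conj_dual_set inner_product_module_pullback[OF P.inner_product_module_axioms]
      hilbert_module_pullback[OF P(1)] self_dual_pullback[OF P.right_module_axioms P(2)]
    by blast
qed

end
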